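(* Let $\omega=\sqrt{-2}$, and let $E_1,E_2,E_3$ be the sets of pairs of integers listed below. $E_1=\{(0,3), (0,4), (0,6), (0,7), (1,1), (1,5), (1,9), (2,1), (2,2), (2,8), (2,9), (3,5), (4,3), (4,5), (4,7), (5,0), (5,2), (5,8), (5,10), (6,0), (6,5), (6,10), (7,2), (7,5), (7,8), (8,4), (8,5), (8,6), (9,1), (9,3), (9,7), (9,9), (10,0), (10,4), (10,6), (10,10)\}$, $E_2=\{(0,3), (0,5), (0,7), (1,0), (1,2), (1,8), (1,10), (2,0), (2,5), (2,10), (3,2), (3,5), (3,8), (4,4), (4,5), (4,6), (5,1), (5,3), (5,7), (5,9), (6,0), (6,4), (6,6), (6,10), (7,3), (7,4), (7,6), (7,7), (8,1), (8,5), (8,9), (9,1), (9,2), (9,8), (9,9), (10,5)\}$, $E_3=\{(0,5), (1,1), (1,2), (1,8), (1,9), (2,1), (2,5), (2,9), (3,3), (3,4), (3,6), (3,7), (4,0), (4,4), (4,6), (4,10), (5,1), (5,3), (5,7), (5,9), (6,4), (6,5), (6,6), (7,2), (7,5), (7,8), (8,0), (8,5), (8,10), (9,0), (9,2), (9,8), (9,10), (10,3), (10,5), (10,7)\}$. Then: (1) for every $(a',b')\in E_1$ there are infinitely many elements $z\in\mathbb{Z}[\omega]$ of the form $z=24a+5+(12b+6)\omega$ with $a,b\in\mathbb{Z}$, $a\equiv a' \pmod{11}$, $b\equiv b'\pmod{11}$, for which there exists a $D(z)$-quadruple in $\mathbb{Z}[\omega]$; (2) for every $(a',b')\in E_2$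 there are infinitely many elements $z\in\mathbb{Z}[\omega]$ of the form $z=24a+2+(12b+6)\omega$ with $a,b\in\mathbb{Z}$, $a\equiv a' \pmod{11}$, $b\equiv b'\pmod{11}$, for which there exists a $D(z)$-quadruple in $\mathbb{Z}[\omega]$; (3) for every $(a',b')\in E_3$ there are infinitely many elements $z\in\mathbb{Z}[\omega]$ of the form $z=48a+44+(24b+12)\omega$ with $a,b\in\mathbb{Z}$, $a\equiv a' \pmod{11}$, $b\equiv b'\pmod{11}$, for which there exists a $D(z)$-quadruple in $\mathbb{Z}[\omega]$.
   Context: $\mathbb{Z}[\omega]=\{p+q\omega : p,q\in\mathbb{Z}\}$ with $\omega=\sqrt{-2}$. For $z\in\mathbb{Z}[\omega]$, a $D(z)$-quadruple in $\mathbb{Z}[\omega]$ is a set $\{a_1,a_2,a_3,a_4\}$ of four distinct nonzero elements of $\mathbb{Z}[\omega]$ such that $a_ia_j+z$ is a square of an element of $\mathbb{Z}[\omega]$ for all $1\le i<j\le 4$. *)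

theory Defs
  imports Complex_Main "HOL-Number_Theory.Cong"
begin

text \<open>We realise the ring $\mathbb{Z}[\sqrt{-2}]$ as a subset of the complex numbers.\<close>

definition omega :: complex (\<open>\<omega>\<close>) where
  "\<omega> = csqrt (-2)"

definition Z_omega :: "complex set" where
  "Z_omega = {of_int p + of_int q * \<omega> | p q :: int. True}"

definition D_quadruple :: "complex \<Rightarrow> complex set \<Rightarrow> bool" where
  "D_quadruple z A \<longleftrightarrow>
     A \<subseteq> Z_omega \<and> card A = 4 \<and> 0 \<notin> A \<and>
     (\<forall>x\<in>A. \<forall>y\<in>A. x \<noteq> y \<longrightarrow> (\<exists>w\<in>Z_omega. x * y + z = w\<^sup>2))"

definition E1 :: "(int \<times> int) set" where
  "E1 = {
    (0,3), (0,4), (0,6), (0,7), (1,1), (1,5), (1,9), (2,1), (2,2),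
    (2,8), (2,9), (3,5), (4,3), (4,5), (4,7), (5,0), (5,2), (5,8),
    (5,10), (6,0), (6,5), (6,10), (7,2), (7,5), (7,8), (8,4), (8,5),
    (8,6), (9,1), (9,3), (9,7), (9,9), (10,0), (10,4), (10,6), (10,10)}"

definition E2 :: "(int \<times> int) set" where
  "E2 = {
    (0,3), (0,5), (0,7), (1,0), (1,2), (1,8), (1,10), (2,0), (2,5),
    (2,10), (3,2), (3,5), (3,8), (4,4), (4,5), (4,6), (5,1), (5,3),
    (5,7), (5,9), (6,0), (6,4), (6,6), (6,10), (7,3), (7,4), (7,6),
    (7,7), (8,1), (8,5), (8,9), (9,1), (9,2), (9,8), (9,9), (10,5)}"

definition E3 :: "(int \<times> int) set" where
  "E3 = {
    (0,5), (1,1), (1,2), (1,8), (1,9), (2,1), (2,5), (2,9), (3,3),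
    (3,4), (3,6), (3,7), (4,0), (4,4), (4,6), (4,10), (5,1), (5,3),
    (5,7), (5,9), (6,4), (6,5), (6,6), (7,2), (7,5), (7,8), (8,0),
    (8,5), (8,10), (9,0), (9,2), (9,8), (9,10), (10,3), (10,5), (10,7)}"

end

theory Submission
  imports Defs
begin

text \<open>
  If \<open>A\<close> is a \<open>D(z)\<close>-quadruple and \<open>w \<noteq> 0\<close>, then \<open>w A\<close> is a \<open>D(w\<^sup>2 z)\<close>-quadruple
  (lemma \<open>D_quadruple_scale\<close>). Hence a single quadruple produces one for every number in the
  orbit of \<open>z\<close> under nonzero squares, and each part of the theorem becomes a statement
  about such an orbit.

  The factors used are \<open>w = 1 + 24 (p + q \<omega>)\<close>. Since \<open>w\<^sup>2 \<equiv> 1\<close> modulo \<open>48\<close>, multiplying by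
  \<open>w\<^sup>2\<close> preserves each of the three arithmetic shapes of \<open>z\<close>. Since \<open>24\<close> is a unit modulo \<open>11\<close>,
  \<open>w\<close> nevertheless takes every residue modulo \<open>11\<close>. Every residue class of pairs \<open>(a, b)\<close> that
  occurs in the orbit occurs infinitely often, because \<open>p\<close> may be shifted by multiples of
  \<open>11\<close> (lemma \<open>infinite_D_quadruples_in_class\<close>).

  It remains to find orbits that meet the prescribed classes. In \<open>\<int>[\<omega>]\<close> the prime \<open>11\<close>
  splits as \<open>(3 + \<omega>) (3 - \<omega>)\<close>, and in each part the listed pairs are exactly those for which \<open>z\<close>
  is zero or a quadratic nonresidue modulo both factors: \<open>6 \<cdot> 6 = 36\<close> pairs. The quotient of two
  nonresidues is a square, and zero is reached by a \<open>w\<close> divisible by the prime, so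
  by the Chinese remainder theorem any one \<open>z\<close> that is a nonresidue modulo both factors has
  all \<open>36\<close> classes in its orbit. Two explicit
  quadruples, for \<open>z = 29 + 66 \<omega>\<close> and \<open>z = -70 + 18 \<omega>\<close>, settle the first two parts.
  Multiplying the second one by \<open>\<omega>\<close> gives a quadruple for \<open>140 - 36 \<omega>\<close>, which settles the third;
  as \<open>\<omega>\<^sup>2 = -2 \<equiv> 3\<^sup>2\<close> modulo \<open>11\<close>, this does not affect the residue characters.
\<close>

section \<open>Arithmetic in the quadratic ring\<close>

definition zw :: "int \<Rightarrow> int \<Rightarrow> complex" where
  "zw p q = of_int p + of_int q * \<omega>"

lemma omega_eq: "\<omega> = \<i> * of_real (sqrt 2)"
  unfolding omega_def using csqrt_of_real_nonpos[of "-2"] by simp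

lemma omega_square: "\<omega> * \<omega> = -2"
  unfolding omega_def by (metis power2_csqrt power2_eq_square)

lemma zw_eq_iff [simp]: "zw p q = zw p' q' \<longleftrightarrow> p = p' \<and> q = q'"
  by (auto simp: zw_def omega_eq complex_eq_iff)

lemma zw_eq_0_iff [simp]: "zw p q = 0 \<longleftrightarrow> p = 0 \<and> q = 0"
  using zw_eq_iff[of p q 0 0] by (simp add: zw_def)

lemma zw_add: "zw p q + zw p' q' = zw (p + p') (q + q')"
  by (simp add: zw_def algebra_simps)

lemma zw_mult: "zw p q * zw p' q' = zw (p * p' - 2 * q * q') (p * q' + q * p')"
proof -
  have "zw p q * zw p' q' =
      of_int (p * p') + of_int (p * q' + q * p') * \<omega> + of_int (q * q') * (\<omega> * \<omega>)"
    by (simp add: zw_def algebra_simps)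
  then show ?thesis
    by (simp add: omega_square zw_def algebra_simps)
qed

lemma Z_omega_eq: "Z_omega = {zw p q | p q. True}"
  by (simp add: Z_omega_def zw_def)

lemma zw_in_Z_omega [simp]: "zw p q \<in> Z_omega"
  by (auto simp: Z_omega_eq)

lemma Z_omega_mult: "x \<in> Z_omega \<Longrightarrow> y \<in> Z_omega \<Longrightarrow> x * y \<in> Z_omega"
  by (auto simp: Z_omega_eq zw_mult)

section \<open>Scaling and spreading quadruples\<close>

lemma D_quadruple_scale:
  assumes A: "D_quadruple z A" and w: "w \<in> Z_omega" "w \<noteq> 0"
  shows "D_quadruple (w\<^sup>2 * z) ((*) w ` A)"
proof -
  have "inj_on ((*) w) A"
    using w by (auto intro: inj_onI)
  then have "card ((*) w ` A) = 4"
    using A by (simp add: card_image D_quadruple_def)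
  moreover have "\<exists>v\<in>Z_omega. (w * x) * (w * y) + w\<^sup>2 * z = v\<^sup>2"
    if "x \<in> A" "y \<in> A" "x \<noteq> y" for x y
  proof -
    have "\<exists>u\<in>Z_omega. x * y + z = u\<^sup>2"
      using A that by (simp add: D_quadruple_def)
    then obtain u where "u \<in> Z_omega" "x * y + z = u\<^sup>2"
      by blast
    then have "(w * x) * (w * y) + w\<^sup>2 * z = (w * u)\<^sup>2" "w * u \<in> Z_omega"
      using w Z_omega_mult by (auto simp: power2_eq_square algebra_simps simp flip: distrib_left)
    then show ?thesis by blast
  qed
  moreover have "(*) w ` A \<subseteq> Z_omega" "0 \<notin> (*) w ` A"
    using A w Z_omega_mult by (auto simp: D_quadruple_def)
  ultimately show ?thesis
    unfolding D_quadruple_def by auto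
qed

text \<open>
  The class of the parameter pair \<open>(a, b)\<close> modulo \<open>11\<close> after multiplying
  \<open>z = m + n \<omega> = (M a + c) + (N b + d) \<omega>\<close> by \<open>w\<^sup>2\<close>, where \<open>w = 1 + 24 (p + q \<omega>)\<close> and
  \<open>k = 48 / M\<close>, \<open>l = 48 / N\<close>. The formula comes from writing \<open>w\<^sup>2 = 1 + 48 (P + Q \<omega>)\<close>, so that
  \<open>w\<^sup>2 z - z = 48 (m + n \<omega>) (P + Q \<omega>)\<close>. The exact coefficients are \<open>P = p + 12 (p\<^sup>2 - 2 q\<^sup>2)\<close>
  and \<open>Q = q + 24 p q\<close>; their constants \<open>12\<close> and \<open>24\<close> are reduced to \<open>1\<close> and \<open>2\<close> here.
\<close>

definition orbit_residue ::
    "int \<Rightarrow> int \<Rightarrow> int \<Rightarrow> int \<Rightarrow> int \<Rightarrow> int \<Rightarrow> int \<times> int \<Rightarrow> int \<times> int" where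
  "orbit_residue k l a b m n = (\<lambda>(p, q).
     let P = p + p\<^sup>2 - 2 * q\<^sup>2; Q = q + 2 * p * q
     in ((a + k * (m * P - 2 * n * Q)) mod 11, (b + l * (m * Q + n * P)) mod 11))"

text \<open>
  Replacing \<open>p\<close> by \<open>p + 11 t\<close> leaves the residues alone and gives a new \<open>w\<close> for each \<open>t\<close>.
  Taking \<open>p\<close> and \<open>t\<close> nonnegative keeps the rational part of \<open>w\<close> positive, so that distinct
  \<open>w\<close> have distinct squares.
\<close>

lemma infinite_D_quadruples_in_class:
  fixes M N k l a b c d p q :: int
  defines "m \<equiv> M * a + c" and "n \<equiv> N * b + d"
  assumes A: "D_quadruple (zw m n) A" and nz: "zw m n \<noteq> 0"
    and M: "M * k = 48" and N: "N * l = 48" and p: "p \<ge> 0"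
    and res: "orbit_residue k l a b m n (p, q) = (a', b')"
  shows "infinite {z. \<exists>a b :: int. z = of_int (M * a + c) + of_int (N * b + d) * \<omega> \<and>
           [a = a'] (mod 11) \<and> [b = b'] (mod 11) \<and> (\<exists>A. D_quadruple z A)}"
    (is "infinite ?S")
proof -
  define r where "r t = p + 11 * int t" for t
  define w where "w t = zw (1 + 24 * r t) (24 * q)" for t
  have w_nz: "w t \<noteq> 0" for t
    using p by (simp add: w_def r_def)
  have inj: "inj (\<lambda>t. (w t)\<^sup>2 * zw m n)"
  proof (rule injI)
    fix s t assume "(w s)\<^sup>2 * zw m n = (w t)\<^sup>2 * zw m n"
    then have "w s = w t \<or> w s = - w t"
      using nz by (simp only: mult_cancel_right power2_eq_iff) simp
    then have "w s = w t \<or> w s + w t = 0"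
      by auto
    moreover have "w s + w t \<noteq> 0"
      using p by (simp add: w_def zw_add r_def)
    ultimately show "s = t"
      by (simp add: w_def r_def)
  qed
  have "(w t)\<^sup>2 * zw m n \<in> ?S" for t
  proof -
    define P where "P = r t + 12 * ((r t)\<^sup>2 - 2 * q\<^sup>2)"
    define Q where "Q = q + 24 * r t * q"
    define a1 where "a1 = a + k * (m * P - 2 * n * Q)"
    define b1 where "b1 = b + l * (m * Q + n * P)"
    have "(w t)\<^sup>2 = zw (1 + 48 * P) (48 * Q)"
      by (simp add: w_def power2_eq_square zw_mult P_def Q_def algebra_simps)
    then have "(w t)\<^sup>2 * zw m n = zw (m + 48 * (m * P - 2 * n * Q)) (n + 48 * (m * Q + n * P))"
      by (simp add: zw_mult algebra_simps)
    also have "\<dots> = zw (M * a1 + c) (N * b1 + d)"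
      by (simp add: a1_def b1_def m_def n_def distrib_left mult.assoc [symmetric] M N)
    finally have eq: "(w t)\<^sup>2 * zw m n = zw (M * a1 + c) (N * b1 + d)" .
    have cr: "[r t = p] (mod 11)"
      by (simp add: r_def cong_def)
    have cP: "[P = p + p\<^sup>2 - 2 * q\<^sup>2] (mod 11)"
    proof -
      have "[P = r t + 1 * ((r t)\<^sup>2 - 2 * q\<^sup>2)] (mod 11)"
        unfolding P_def by (intro cong_add cong_mult cong_refl) (simp add: cong_def)
      also have "[r t + 1 * ((r t)\<^sup>2 - 2 * q\<^sup>2) = p + 1 * (p\<^sup>2 - 2 * q\<^sup>2)] (mod 11)"
        by (intro cong_add cong_mult cong_diff cong_pow cong_refl cr)
      finally show ?thesis by (simp add: add_diff_eq)
    qed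
    have cQ: "[Q = q + 2 * p * q] (mod 11)"
      unfolding Q_def
      by (intro cong_add cong_mult cong_refl cr) (simp add: cong_def)
    have "[a1 = a + k * (m * (p + p\<^sup>2 - 2 * q\<^sup>2) - 2 * n * (q + 2 * p * q))] (mod 11)"
      unfolding a1_def by (intro cong_add cong_mult cong_diff cong_refl cP cQ)
    then have "[a1 = a'] (mod 11)"
      using res by (auto simp: orbit_residue_def Let_def cong_def)
    moreover have "[b1 = b + l * (m * (q + 2 * p * q) + n * (p + p\<^sup>2 - 2 * q\<^sup>2))] (mod 11)"
      unfolding b1_def by (intro cong_add cong_mult cong_refl cP cQ)
    then have "[b1 = b'] (mod 11)"
      using res by (auto simp: orbit_residue_def Let_def cong_def)
    moreover have "\<exists>B. D_quadruple ((w t)\<^sup>2 * zw m n) B"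
      using D_quadruple_scale[OF A _ w_nz] by (auto simp: w_def)
    ultimately show ?thesis
      using eq by (auto simp: zw_def)
  qed
  then have "range (\<lambda>t. (w t)\<^sup>2 * zw m n) \<subseteq> ?S"
    by blast
  moreover have "infinite (range (\<lambda>t. (w t)\<^sup>2 * zw m n))"
    using finite_imageD[OF _ inj] by auto
  ultimately show ?thesis
    using infinite_super by blast
qed

section \<open>Explicit quadruples and the residues modulo 11\<close>

lemma D_quadrupleI:
  assumes "{x1, x2, x3, x4} \<subseteq> Z_omega" "distinct [x1, x2, x3, x4]" "0 \<notin> {x1, x2, x3, x4}"
    and "\<And>x y. (x, y) \<in> {(x1, x2), (x1, x3), (x1, x4), (x2, x3), (x2, x4), (x3, x4)}
           \<Longrightarrow> \<exists>w\<in>Z_omega. x * y + z = w\<^sup>2"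
  shows "D_quadruple z {x1, x2, x3, x4}"
proof -
  have "\<exists>w\<in>Z_omega. x * y + z = w\<^sup>2"
    if "x \<in> {x1, x2, x3, x4}" "y \<in> {x1, x2, x3, x4}" "x \<noteq> y" for x y
    using that assms(4)[of x y] assms(4)[of y x] by (auto simp: mult.commute)
  then show ?thesis
    using assms(1-3) unfolding D_quadruple_def by auto
qed

lemma zw_square_witness:
  assumes "p * p' - 2 * q * q' + m = r\<^sup>2 - 2 * s\<^sup>2" "p * q' + q * p' + n = 2 * r * s"
  shows "\<exists>w\<in>Z_omega. zw p q * zw p' q' + zw m n = w\<^sup>2"
  using assms
  by (intro bexI[of _ "zw r s"]) (simp_all add: zw_mult zw_add power2_eq_square)

text \<open>
  This quadruple and the next come from a computer search for four-cliques among the elements of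
  small norm, two elements \<open>x\<close>, \<open>y\<close> being joined when \<open>x y + z\<close> is a square. In each use of
  \<open>zw_square_witness\<close> the two arguments before the last are the coordinates of a square root.
\<close>

lemma D_quadruple_29_66:
  "D_quadruple (zw 29 66) {zw (-6) (-4), zw 10 9, zw 14 (-15), zw 18 1}"
proof (rule D_quadrupleI)
  fix x y
  assume "(x, y) \<in> {(zw (-6) (-4), zw 10 9), (zw (-6) (-4), zw 14 (-15)), (zw (-6) (-4), zw 18 1),
    (zw 10 9, zw 14 (-15)), (zw 10 9, zw 18 1), (zw 14 (-15), zw 18 1)}"
  then show "\<exists>w\<in>Z_omega. x * y + zw 29 66 = w\<^sup>2"
    using zw_square_witness[of "-6" 10 "-4" 9 29 7 "-2" 66]
      zw_square_witness[of "-6" 14 "-4" "-15" 29 5 10 66]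
      zw_square_witness[of "-6" 18 "-4" 1 29 1 "-6" 66]
      zw_square_witness[of 10 14 9 "-15" 29 21 1 66]
      zw_square_witness[of 10 18 9 1 29 17 7 66]
      zw_square_witness[of 14 18 "-15" 1 29 19 "-5" 66]
    by auto
qed simp_all

lemma D_quadruple_minus_70_18:
  "D_quadruple (zw (-70) 18) {zw 6 (-4), zw 7 3, zw 9 (-5), zw 23 (-21)}"
proof (rule D_quadrupleI)
  fix x y
  assume "(x, y) \<in> {(zw 6 (-4), zw 7 3), (zw 6 (-4), zw 9 (-5)), (zw 6 (-4), zw 23 (-21)),
    (zw 7 3, zw 9 (-5)), (zw 7 3, zw 23 (-21)), (zw 9 (-5), zw 23 (-21))}"
  then show "\<exists>w\<in>Z_omega. x * y + zw (-70) 18 = w\<^sup>2"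
    using zw_square_witness[of 6 7 "-4" 3 "-70" 2 2 18]
      zw_square_witness[of 6 9 "-4" "-5" "-70" 4 "-6" 18]
      zw_square_witness[of 6 23 "-4" "-21" "-70" 10 "-10" 18]
      zw_square_witness[of 7 9 3 "-5" "-70" 5 1 18]
      zw_square_witness[of 7 23 3 "-21" "-70" 15 "-2" 18]
      zw_square_witness[of 9 23 "-5" "-21" "-70" 13 "-11" 18]
    by auto
qed simp_all

lemma D_quadruple_140_minus_36: "\<exists>A. D_quadruple (zw 140 (-36)) A"
proof -
  have "(zw 0 1)\<^sup>2 * zw (-70) 18 = zw 140 (-36)"
    by (simp add: power2_eq_square zw_mult)
  then show ?thesis
    using D_quadruple_scale[OF D_quadruple_minus_70_18, of "zw 0 1"] by auto
qed

text \<open>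
  These inclusions are the Chinese remainder argument modulo \<open>11\<close>, carried out as a finite
  enumeration: \<open>1 + 24 (p + q \<omega>)\<close> takes every residue modulo \<open>11\<close> as \<open>p\<close> and \<open>q\<close> range
  over \<open>{0..10}\<close>.
\<close>

lemma E1_subset_orbit: "E1 \<subseteq> orbit_residue 2 4 1 5 29 66 ` ({0..10} \<times> {0..10})"
  by code_simp

lemma E2_subset_orbit: "E2 \<subseteq> orbit_residue 2 4 (-3) 1 (-70) 18 ` ({0..10} \<times> {0..10})"
  by code_simp

lemma E3_subset_orbit: "E3 \<subseteq> orbit_residue 1 2 2 (-2) 140 (-36) ` ({0..10} \<times> {0..10})"
  by code_simp

theorem theorem1p7:
  shows "(\<forall>(a', b') \<in> E1. infinite {z. \<exists>a b :: int.
            z = of_int (24 * a + 5) + of_int (12 * b + 6) * \<omega> \<and>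
            [a = a'] (mod 11) \<and> [b = b'] (mod 11) \<and>
            (\<exists>A. D_quadruple z A)}) \<and>
         (\<forall>(a', b') \<in> E2. infinite {z. \<exists>a b :: int.
            z = of_int (24 * a + 2) + of_int (12 * b + 6) * \<omega> \<and>
            [a = a'] (mod 11) \<and> [b = b'] (mod 11) \<and>
            (\<exists>A. D_quadruple z A)}) \<and>
         (\<forall>(a', b') \<in> E3. infinite {z. \<exists>a b :: int.
            z = of_int (48 * a + 44) + of_int (24 * b + 12) * \<omega> \<and>
            [a = a'] (mod 11) \<and> [b = b'] (mod 11) \<and>
            (\<exists>A. D_quadruple z A)})"
proof (intro conjI ballI; clarify)
  fix a' b' assume "(a', b') \<in> E1"
  then obtain p q where "p \<ge> 0" "orbit_residue 2 4 1 5 29 66 (p, q) = (a', b')"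
    using E1_subset_orbit by fastforce
  moreover assume "finite {z. \<exists>a b :: int.
      z = of_int (24 * a + 5) + of_int (12 * b + 6) * \<omega> \<and>
      [a = a'] (mod 11) \<and> [b = b'] (mod 11) \<and> (\<exists>A. D_quadruple z A)}"
  ultimately show False
    using infinite_D_quadruples_in_class[of 24 1 5 12 5 6 _ 2 4 p q a' b'] D_quadruple_29_66
    by auto
next
  fix a' b' assume "(a', b') \<in> E2"
  then obtain p q where "p \<ge> 0" "orbit_residue 2 4 (-3) 1 (-70) 18 (p, q) = (a', b')"
    using E2_subset_orbit by fastforce
  moreover assume "finite {z. \<exists>a b :: int.
      z = of_int (24 * a + 2) + of_int (12 * b + 6) * \<omega> \<and>
      [a = a'] (mod 11) \<and> [b = b'] (mod 11) \<and> (\<exists>A. D_quadruple z A)}"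
  ultimately show False
    using infinite_D_quadruples_in_class[of 24 "-3" 2 12 1 6 _ 2 4 p q a' b']
      D_quadruple_minus_70_18
    by auto
next
  fix a' b' assume "(a', b') \<in> E3"
  then obtain p q where "p \<ge> 0" "orbit_residue 1 2 2 (-2) 140 (-36) (p, q) = (a', b')"
    using E3_subset_orbit by fastforce
  moreover assume "finite {z. \<exists>a b :: int.
      z = of_int (48 * a + 44) + of_int (24 * b + 12) * \<omega> \<and>
      [a = a'] (mod 11) \<and> [b = b'] (mod 11) \<and> (\<exists>A. D_quadruple z A)}"
  ultimately show False
    using infinite_D_quadruples_in_class[of 48 2 44 24 "-2" 12 _ 1 2 p q a' b']
      D_quadruple_140_minus_36
    by auto
qed

end
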